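(* Let $d\ge1$ and $\beta\in(1,(d+2)/d)$. The $d$-dimensional Cauchy distributions $\{q_\eta\}$ with index $\beta$, parametrized by $\eta=[\mu_i,\sigma_{ij}]^\top_{i,j\in\{1,\dots,d\},\,i\le j}$, form a $d(d+3)/2$-parameter regular $\mathscr{E}^{(\beta)}$-family.
   Context: Cauchy distributions: for $\beta\in(1,(d+2)/d)$, $\boldsymbol{\mu}=[\mu_1,\dots,\mu_d]^\top\in\mathbb{R}^d$ and $\boldsymbol{\Sigma}=(\sigma_{ij})$ a symmetric positive-definite $d\times d$ matrix, $$q_\eta(\mathbf{x})=M_{\eta,\beta}\big[1+c_\beta(\mathbf{x}-\boldsymbol{\mu})^\top\boldsymbol{\Sigma}^{-1}(\mathbf{x}-\boldsymbol{\mu})\big]^{\frac1{1-\beta}},\quad\mathbf{x}\in\mathbb{R}^d,$$ where $c_\beta=b_{1/\beta}$ with $b_\alpha=\frac{1-\alpha}{2-d(1-\alpha)}$, and $M_{\eta,\beta}$ is the normalizing constant. (Equivalently $q_\eta=p_\theta^{\alpha}/\int p_\theta^{\alpha}$ with $\alpha=1/\beta$, where $p_\theta(\mathbf{x})\propto[1+b_\alpha(\mathbf{x}-\boldsymbol{\mu})^\top\boldsymbol{\Sigma}^{-1}(\mathbf{x}-\boldsymbol{\mu})]^{1/(\alpha-1)}$ is the Student density.) The parameter $\eta=[\mu_i,\sigma_{ij}]^\top_{i\le j}$ ranges over the open set of $\mathbb{R}^{d(d+3)/2}$ for which $\boldsymbol{\Sigma}$ is positive definite. $\mathscr{E}^{(\beta)}$-family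 ($\beta\neq1$): a family of probability distributions $\{p_\theta:\theta\in\Theta\}$ on $\mathbb{R}^d$, $\Theta\subset\mathbb{R}^k$ open, with $\mathbb{S}$ the support of $p_\theta$, is a $k$-parameter $\mathscr{E}^{(\beta)}$-family characterized by $h,w,f,\Theta,\mathbb{S}$ if there are $w=[w_1,\dots,w_s]^\top$ with each $w_i:\Theta\to\mathbb{R}$ differentiable, $f=[f_1,\dots,f_s]^\top$ with $f_i:\mathbb{R}^d\to\mathbb{R}$, $h:\mathbb{R}^d\to\mathbb{R}$, and a differentiable $Z:\Theta\to\mathbb{R}$ (the normalizing factor) with $$p_\theta(\mathbf{x})=Z(\theta)[h(\mathbf{x})+w(\theta)^\top f(\mathbf{x})]^{\frac1{1-\beta}}\ \text{ for }\mathbf{x}\in\mathbb{S},\qquad p_\theta(\mathbf{x})=0\ \text{ otherwise}.$$ It is regular if (i) $\mathbb{S}$ does not depend on $\theta$; (ii) $s=k$; (iii) $1,w_1,\dots,w_s$ are linearly independent functions on $\Theta$; (iv) $f_1,\dots,f_s$ are linearly independent functions on $\mathbb{S}$. *)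

theory Defs
  imports "HOL-Analysis.Analysis" "HOL-Library.Uprod"
begin

instance uprod :: (finite) finite
  by standard simp

definition prob_density :: "('a::euclidean_space \<Rightarrow> real) \<Rightarrow> bool" where
  "prob_density q \<longleftrightarrow> (\<forall>x. 0 \<le> q x) \<and> integrable lborel q \<and> (LINT x|lborel. q x) = 1"

text \<open>Linear independence, as functions on the set \<open>D\<close>, of the indexed family \<open>g 0, \<dots>, g (n - 1)\<close>.\<close>

definition lin_indep_funs :: "'a set \<Rightarrow> nat \<Rightarrow> (nat \<Rightarrow> 'a \<Rightarrow> real) \<Rightarrow> bool" where
  "lin_indep_funs D n g \<longleftrightarrow>
     (\<forall>a. (\<forall>x\<in>D. (\<Sum>i<n. a i * g i x) = 0) \<longrightarrow> (\<forall>i<n. a i = 0))"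

text \<open>
  The conjunct \<open>0 < h x + \<dots>\<close> says that the real power is meaningful on the support:
  the library's \<open>powr\<close> is total, and on negative bases it does not denote a real power.
\<close>

definition E_family ::
  "real \<Rightarrow> nat \<Rightarrow> (real^'k) set \<Rightarrow> (real^'k \<Rightarrow> (real^'n) set) \<Rightarrow> (real^'k \<Rightarrow> real^'n \<Rightarrow> real)
    \<Rightarrow> nat \<Rightarrow> (real^'n \<Rightarrow> real) \<Rightarrow> (nat \<Rightarrow> real^'k \<Rightarrow> real) \<Rightarrow> (nat \<Rightarrow> real^'n \<Rightarrow> real) \<Rightarrow> bool" where
  "E_family \<beta> k \<Theta> S p s h w f \<longleftrightarrow>
     \<beta> \<noteq> 1 \<and> CARD('k) = k \<and> open \<Theta> \<and>
     (\<forall>\<theta>\<in>\<Theta>. prob_density (p \<theta>) \<and> S \<theta> = support_on UNIV (p \<theta>)) \<and>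
     (\<forall>i<s. w i differentiable_on \<Theta>) \<and>
     (\<exists>Z. Z differentiable_on \<Theta> \<and>
        (\<forall>\<theta>\<in>\<Theta>.
           (\<forall>x\<in>S \<theta>. 0 < h x + (\<Sum>i<s. w i \<theta> * f i x) \<and>
                     p \<theta> x = Z \<theta> * (h x + (\<Sum>i<s. w i \<theta> * f i x)) powr (1 / (1 - \<beta>))) \<and>
           (\<forall>x. x \<notin> S \<theta> \<longrightarrow> p \<theta> x = 0)))"

definition regular_E_family ::
  "real \<Rightarrow> nat \<Rightarrow> (real^'k) set \<Rightarrow> (real^'k \<Rightarrow> real^'n \<Rightarrow> real) \<Rightarrow> bool" where
  "regular_E_family \<beta> k \<Theta> p \<longleftrightarrow>
     (\<exists>S s h w f. E_family \<beta> k \<Theta> (\<lambda>_. S) p s h w f \<and>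
        s = k \<and>
        lin_indep_funs \<Theta> (Suc s) (case_nat (\<lambda>_. 1) w) \<and>
        lin_indep_funs S s f)"

definition sym_pos_def :: "real^'n^'n \<Rightarrow> bool" where
  "sym_pos_def A \<longleftrightarrow> transpose A = A \<and> (\<forall>x. x \<noteq> 0 \<longrightarrow> 0 < x \<bullet> (A *v x))"

text \<open>
  A parameter vector has one coordinate \<open>Inl i\<close> for each \<open>\<mu>\<^sub>i\<close> and one coordinate \<open>Inr (Upair i j)\<close>
  for each \<open>\<sigma>\<^sub>i\<^sub>j\<close> with \<open>i \<le> j\<close>; an unordered pair (with \<open>i = j\<close> allowed) stands for its
  unique increasing representative, so that no order on the index type \<open>'n\<close> has to be chosen.
\<close>

type_synonym 'n cauchy_param = "real^('n + 'n uprod)"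

definition loc :: "'n::finite cauchy_param \<Rightarrow> real^'n" where
  "loc \<eta> = (\<chi> i. \<eta> $ Inl i)"

definition scale_mat :: "'n::finite cauchy_param \<Rightarrow> real^'n^'n" where
  "scale_mat \<eta> = (\<chi> i j. \<eta> $ Inr (Upair i j))"

definition cauchy_params :: "'n::finite cauchy_param set" where
  "cauchy_params = {\<eta>. sym_pos_def (scale_mat \<eta>)}"

definition b_coeff :: "nat \<Rightarrow> real \<Rightarrow> real" where
  "b_coeff d \<alpha> = (1 - \<alpha>) / (2 - real d * (1 - \<alpha>))"

definition c_coeff :: "nat \<Rightarrow> real \<Rightarrow> real" where
  "c_coeff d \<beta> = b_coeff d (1 / \<beta>)"

definition cauchy_kernel :: "real \<Rightarrow> 'n::finite cauchy_param \<Rightarrow> real^'n \<Rightarrow> real" where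
  "cauchy_kernel \<beta> \<eta> x =
     (1 + c_coeff CARD('n) \<beta> *
        ((x - loc \<eta>) \<bullet> (matrix_inv (scale_mat \<eta>) *v (x - loc \<eta>)))) powr (1 / (1 - \<beta>))"

definition cauchy_const :: "real \<Rightarrow> 'n::finite cauchy_param \<Rightarrow> real" where
  "cauchy_const \<beta> \<eta> = 1 / (LINT x|lborel. cauchy_kernel \<beta> \<eta> x)"

definition cauchy_density :: "real \<Rightarrow> 'n::finite cauchy_param \<Rightarrow> real^'n \<Rightarrow> real" where
  "cauchy_density \<beta> \<eta> x = cauchy_const \<beta> \<eta> * cauchy_kernel \<beta> \<eta> x"

end

theory Submission
  imports Defs
begin

text \<open>
  Write \<open>P = \<Sigma>\<^sup>-\<^sup>1\<close> and \<open>N = 1 + c \<mu>\<^sup>T P \<mu>\<close>. Expanding \<open>1 + c (x - \<mu>)\<^sup>T P (x - \<mu>)\<close> and dividing by \<open>N\<close>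
  leaves \<open>1\<close> plus a combination of the monomials \<open>x\<^sub>i\<close> and \<open>x\<^sub>i x\<^sub>j\<close>, so \<open>h = 1\<close>, the weights are
  \<open>- 2 c (P \<mu>)\<^sub>i / N\<close> and \<open>c (2 - \<delta>\<^sub>i\<^sub>j) P\<^sub>i\<^sub>j / N\<close>, and a power of \<open>N\<close> goes into \<open>Z\<close>. A linear relation between
  \<open>1\<close> and the weights, multiplied by \<open>N\<close>, is tested at \<open>\<mu> = 0\<close>, at \<open>P = I\<close>, \<open>P = 2 I\<close> and at \<open>P = I + v v\<^sup>T\<close>.
  For the normalizing constant, a \<open>P\<close>-orthonormal basis turns \<open>\<integral> g (x\<^sup>T P x) dx\<close> into
  \<open>(det P)\<^sup>-\<^sup>1\<^sup>/\<^sup>2 \<integral> g (x\<^sup>T x) dx\<close>, which is differentiable in \<open>P\<close>; the latter integral converges because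
  the kernel decays like \<open>\<bar>x\<bar>\<close> to the power \<open>- 2 / (\<beta> - 1)\<close> and \<open>2 / (\<beta> - 1) > d\<close>.
\<close>

section \<open>Positive definite matrices\<close>

lemma sym_pos_def_invertible:
  assumes "sym_pos_def P"
  shows "invertible P"
proof -
  have "P *v x = 0 \<Longrightarrow> x = 0" for x
    using assms unfolding sym_pos_def_def by (metis inner_zero_right less_irrefl)
  then show ?thesis
    by (simp add: invertible_left_inverse matrix_left_invertible_ker)
qed

lemma matrix_inv_mult:
  fixes A :: "'a::field^'n^'n"
  assumes "invertible A"
  shows "A ** matrix_inv A = mat 1" "matrix_inv A ** A = mat 1"
proof -
  have "A ** matrix_inv A = mat 1 \<and> matrix_inv A ** A = mat 1"
    using assms unfolding invertible_def matrix_inv_def by (rule someI_ex)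
  then show "A ** matrix_inv A = mat 1" "matrix_inv A ** A = mat 1" by auto
qed

lemma matrix_inv_eqI:
  fixes A :: "'a::field^'n^'n"
  assumes "A ** B = mat 1"
  shows "matrix_inv A = B"
proof -
  have "B ** A = mat 1" 
    using assms matrix_left_right_inverse by blast
  then have "invertible A"
    using assms invertible_def by blast
  then have "matrix_inv A ** (A ** B) = B"
    by (simp add: matrix_mul_assoc matrix_inv_mult)
  then show ?thesis
    by (simp add: assms)
qed

lemma matrix_inv_matrix_inv:
  fixes A :: "'a::field^'n^'n"
  assumes "invertible A"
  shows "matrix_inv (matrix_inv A) = A"
  by (rule matrix_inv_eqI) (simp add: assms matrix_inv_mult)

text \<open>With \<open>y = Q x\<close> the form \<open>x . Q x\<close> equals
  \<open>y . P y\<close>; symmetry comes from transposing \<open>Q P = I\<close> and uniqueness of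
  the inverse.\<close>

lemma sym_pos_def_matrix_inv:
  assumes P: "sym_pos_def P"
  shows "sym_pos_def (matrix_inv P)"
proof -
  let ?Q = "matrix_inv P"
  have inv: "P ** ?Q = mat 1" "?Q ** P = mat 1"
    using P by (simp_all add: matrix_inv_mult sym_pos_def_invertible)
  have "P ** transpose ?Q = mat 1"
    using P inv by (metis matrix_transpose_mul sym_pos_def_def transpose_mat)
  then have "transpose ?Q = ?Q"
    by (metis matrix_inv_eqI)
  moreover have "0 < x \<bullet> (?Q *v x)" if "x \<noteq> 0" for x
  proof -
    have x: "P *v (?Q *v x) = x"
      by (simp add: matrix_vector_mul_assoc inv)
    then have "?Q *v x \<noteq> 0"
      using that by (metis matrix_vector_mult_0_right)
    then have "0 < (?Q *v x) \<bullet> (P *v (?Q *v x))"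
      using P sym_pos_def_def by blast
    then show ?thesis
      by (simp add: x inner_commute)
  qed
  ultimately show ?thesis
    by (simp add: sym_pos_def_def)
qed

lemma inner_matrix_vector_sum:
  fixes A :: "real^'n^'m"
  shows "x \<bullet> (A *v y) = (\<Sum>i\<in>UNIV. \<Sum>j\<in>UNIV. A $ i $ j * (x $ i * y $ j))"
  by (simp add: inner_vec_def matrix_vector_mult_def sum_distrib_left mult_ac)

lemma inner_symmetric_matrix:
  fixes A :: "real^'n^'n"
  assumes "transpose A = A"
  shows "x \<bullet> (A *v y) = y \<bullet> (A *v x)"
  by (metis assms dot_lmul_matrix inner_commute transpose_matrix_vector)

lemma sym_pos_def_nonneg: "sym_pos_def P \<Longrightarrow> 0 \<le> x \<bullet> (P *v x)"
  by (cases "x = 0") (auto simp: sym_pos_def_def less_imp_le)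

lemma sym_pos_def_scaleR:
  assumes "sym_pos_def P" "0 < t"
  shows "sym_pos_def (t *\<^sub>R P)"
  using assms by (simp add: sym_pos_def_def transpose_scalar scaleR_matrix_vector_assoc [symmetric])

text \<open>The form of \<open>I + v v^T\<close> is \<open>|x|^2 + (x . v)^2\<close>. Subtracting
  \<open>I\<close> leaves \<open>v v^T\<close>, on which linear functionals of matrices are tested
  later.\<close>

lemma sym_pos_def_mat_1_plus_outer:
  fixes v :: "real^'n"
  shows "sym_pos_def (\<chi> i j. (if i = j then 1 else 0) + v $ i * v $ j)" (is "sym_pos_def ?A")
proof -
  have "(?A *v x) $ i = x $ i + v $ i * (x \<bullet> v)" for x i
    by (simp add: matrix_vector_mult_def inner_vec_def sum.distrib distrib_left sum_distrib_left
        if_distrib [where f="(*) _"] mult_ac cong: if_cong)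
  then have "x \<bullet> (?A *v x) = x \<bullet> x + (x \<bullet> v)\<^sup>2" for x
    by (simp add: inner_vec_def distrib_left sum.distrib power2_eq_square sum_distrib_right mult_ac)
  moreover have "0 < x \<bullet> x + (x \<bullet> v)\<^sup>2" if "x \<noteq> 0" for x
    using that by (simp add: add_pos_nonneg)
  ultimately show ?thesis
    by (simp add: sym_pos_def_def transpose_def vec_eq_iff mult.commute)
qed

lemma sym_pos_def_mat_1: "sym_pos_def (mat 1)"
  by (simp add: sym_pos_def_def transpose_mat)

text \<open>Gram-Schmidt for the inner product \<open>x . P y\<close>, adding one index at a
  time.\<close>

lemma sym_pos_def_orthonormal_family:
  fixes P :: "real^'n^'n"
  assumes P: "sym_pos_def P" and "finite S"
  shows "\<exists>v::'n \<Rightarrow> real^'n. \<forall>i\<in>S. \<forall>j\<in>S. v i \<bullet> (P *v v j) = (if i = j then 1 else 0)"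
  using \<open>finite S\<close>
proof (induction S rule: finite_induct)
  case empty
  show ?case by simp
next
  case (insert a S)
  then obtain v where v: "\<And>i j. i \<in> S \<Longrightarrow> j \<in> S \<Longrightarrow> v i \<bullet> (P *v v j) = (if i = j then 1 else 0)"
    by blast
  let ?T = "(\<lambda>i. P *v v i) ` S"
  \<comment> \<open>As \<open>a\<close> is not in \<open>S\<close>, the vectors
    \<open>P *v v i\<close> number fewer than the dimension, so some nonzero \<open>x\<close> is
    orthogonal to all of them.\<close>
  have "dim ?T \<le> card S"
    by (meson card_image_le dim_le_card' finite_imageI insert.hyps(1) le_trans)
  also have "\<dots> < card (insert a S)"
    using insert by simp
  also have "\<dots> \<le> DIM(real^'n)"
    by (simp add: card_mono)
  finally obtain x where x: "x \<noteq> 0" and orth: "\<And>y. y \<in> span ?T \<Longrightarrow> orthogonal x y"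
    using orthogonal_to_subspace_exists by metis
  let ?q = "x \<bullet> (P *v x)"
  have q: "0 < ?q"
    using P x by (simp add: sym_pos_def_def)
  define u where "u = (1 / sqrt ?q) *\<^sub>R x"
  have xv: "x \<bullet> (P *v v i) = 0" if "i \<in> S" for i
    using orth that by (simp add: orthogonal_def span_base)
  have uv: "u \<bullet> (P *v v i) = 0" "v i \<bullet> (P *v u) = 0" if "i \<in> S" for i
    using xv [OF that] P inner_symmetric_matrix [of P "v i" u]
    by (simp_all add: u_def sym_pos_def_def)
  have uu: "u \<bullet> (P *v u) = 1"
    using q by (simp add: u_def matrix_vector_mult_scaleR real_div_sqrt field_simps)
  have "\<forall>i\<in>insert a S. \<forall>j\<in>insert a S.
     (v(a := u)) i \<bullet> (P *v (v(a := u)) j) = (if i = j then 1 else 0)"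
    using insert.hyps uv uu v by auto
  then show ?case by blast
qed

text \<open>The columns of \<open>B\<close> form a \<open>P\<close>-orthonormal basis, and the
  product is their Gram matrix.\<close>

lemma sym_pos_def_congruent_mat_1:
  fixes P :: "real^'n^'n"
  assumes P: "sym_pos_def P"
  obtains B :: "real^'n^'n" where "transpose B ** P ** B = mat 1"
proof -
  obtain v :: "'n \<Rightarrow> real^'n" where v: "\<And>i j. v i \<bullet> (P *v v j) = (if i = j then 1 else 0)"
    using sym_pos_def_orthonormal_family [OF P finite [of UNIV]] by auto
  let ?B = "\<chi> i j. v j $ i"
  have "(transpose ?B ** P ** ?B) $ i $ j = v i \<bullet> (P *v v j)" for i j
    by (simp add: matrix_matrix_mult_def transpose_def inner_vec_def matrix_vector_mult_def
        sum_distrib_left sum_distrib_right mult_ac) (rule sum.swap)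
  then have "transpose ?B ** P ** ?B = mat 1"
    by (simp add: vec_eq_iff v mat_def)
  then show thesis by (rule that)
qed

lemma sym_pos_def_det_pos:
  fixes P :: "real^'n^'n"
  assumes P: "sym_pos_def P"
  shows "0 < det P"
proof -
  obtain B :: "real^'n^'n" where "transpose B ** P ** B = mat 1"
    using sym_pos_def_congruent_mat_1 [OF P] .
  then have "det (transpose B ** P ** B) = 1"
    by simp
  then have det: "(det B)\<^sup>2 * det P = 1"
    by (simp add: det_mul power2_eq_square mult_ac)
  then have "det B \<noteq> 0" by auto
  with det show ?thesis
    by (intro zero_less_mult_pos [of "(det B)\<^sup>2" "det P"]) auto
qed

section \<open>Integrals of functions of a quadratic form\<close>

text \<open>
  The library's change of variables in \<open>real^'m\<close> needs a well-ordered index type \<open>'m\<close>;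
  \<open>'n idx\<close> is one with as many elements as \<open>'n\<close>.
\<close>

typedef ('n::finite) idx = "{..<CARD('n)}"
  by (rule exI [of _ 0]) (simp add: card_gt_0_iff)

instantiation idx :: (finite) linorder
begin

definition less_eq_idx :: "'a idx \<Rightarrow> 'a idx \<Rightarrow> bool" where
  "less_eq_idx i j \<longleftrightarrow> Rep_idx i \<le> Rep_idx j"

definition less_idx :: "'a idx \<Rightarrow> 'a idx \<Rightarrow> bool" where
  "less_idx i j \<longleftrightarrow> Rep_idx i < Rep_idx j"

instance
  by standard (auto simp: less_eq_idx_def less_idx_def Rep_idx_inject)

end

instance idx :: (finite) wellorder
proof
  fix Q :: "'a idx \<Rightarrow> bool" and i
  assume step: "\<And>i. (\<And>j. j < i \<Longrightarrow> Q j) \<Longrightarrow> Q i"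
  show "Q i"
    by (induction i rule: measure_induct_rule [where f = Rep_idx]) (rule step, simp add: less_idx_def)
qed

instance idx :: (finite) finite
proof
  have "inj (Rep_idx :: 'a idx \<Rightarrow> nat)" "range (Rep_idx :: 'a idx \<Rightarrow> nat) \<subseteq> {..<CARD('a)}"
    using Rep_idx by (auto simp: inj_def Rep_idx_inject)
  then show "finite (UNIV :: 'a idx set)"
    by (meson finite_lessThan inj_on_finite)
qed

section \<open>Renaming coordinates and linear substitution in Lebesgue integrals\<close>

lemma card_idx: "CARD('n::finite idx) = CARD('n)"
  using type_definition.card [OF type_definition_idx [where 'n='n]] by simp

text \<open>Lebesgue measure is determined by its values on boxes; the preimage of a box is a box
  with the same side lengths in another order.\<close>

lemma lborel_distr_reindex:
  fixes e :: "'m::finite \<Rightarrow> 'n::finite"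
  assumes e: "bij e"
  shows "distr lborel borel (\<lambda>y::real^'m. \<chi> i. y $ inv e i) = lborel" (is "distr _ _ ?T = _")
proof (rule sym, rule lborel_eqI)
  have [measurable]: "?T \<in> borel \<rightarrow>\<^sub>M borel"
    by (intro borel_measurable_continuous_onI continuous_intros)
  have inv: "inv e (e a) = a" "e (inv e i) = i" for a i
    using e by (simp_all add: bij_is_inj bij_is_surj surj_f_inv_f)
  fix l u :: "real^'n"
  assume le: "\<And>b. b \<in> Basis \<Longrightarrow> l \<bullet> b \<le> u \<bullet> b"
  then have le': "l $ i \<le> u $ i" for i
    by (metis axis_in_Basis_iff cart_eq_inner_axis insertI1 Basis_real_def)
  have "?T -` box l u = box (\<chi> a. l $ e a) (\<chi> a. u $ e a)"
    unfolding set_eq_iff vimage_eq mem_box_cart by (auto simp: inv) (metis inv)+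
  then have "emeasure (distr lborel borel ?T) (box l u)
      = emeasure lborel (box (\<chi> a. l $ e a) (\<chi> a. u $ e a) :: (real^'m) set)"
    by (simp add: emeasure_distr)
  also have "\<dots> = (\<Prod>b\<in>Basis. ((\<chi> a. u $ e a) - (\<chi> a. l $ e a) :: real^'m) \<bullet> b)"
    by (rule emeasure_lborel_box) (use le' in \<open>auto simp: Basis_vec_def inner_axis\<close>)
  also have "\<dots> = (\<Prod>a\<in>UNIV. u $ e a - l $ e a)"
    by (subst prod.reindex_bij_betw [symmetric, where h="\<lambda>a. axis a 1" and S=UNIV])
       (auto simp: Basis_vec_def bij_betw_def inj_on_def axis_eq_axis inner_axis)
  also have "\<dots> = (\<Prod>i\<in>UNIV. u $ i - l $ i)"
    by (simp add: prod.reindex_bij_betw [OF e, of "\<lambda>i. u $ i - l $ i"])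
  also have "\<dots> = (\<Prod>b\<in>Basis. (u - l) \<bullet> b)"
    by (subst prod.reindex_bij_betw [symmetric, where h="\<lambda>a. axis a 1" and S=UNIV and T=Basis])
       (auto simp: Basis_vec_def bij_betw_def inj_on_def axis_eq_axis inner_axis)
  finally show "emeasure (distr lborel borel ?T) (box l u) = (\<Prod>b\<in>Basis. (u - l) \<bullet> b)" .
qed simp

text \<open>Integrability passes both ways under an invertible \<open>B\<close>. When it fails, both
  integrals have the default value 0, so the identity of integrals still holds.\<close>

lemma

  fixes f :: "real^'m::{finite,wellorder} \<Rightarrow> real" and B :: "real^'m::_^'m::_"
  assumes f [measurable]: "f \<in> borel_measurable borel" and B: "det B \<noteq> 0"
  shows integrable_linear_substitution: "integrable lborel (\<lambda>x. f (B *v x)) \<longleftrightarrow> integrable lborel f" (is ?I)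
    and integral_linear_substitution: "(LINT x|lborel. f x) = \<bar>det B\<bar> * (LINT x|lborel. f (B *v x))" (is ?E)
proof -
  have [measurable]: "(\<lambda>x. B *v x) \<in> borel \<rightarrow>\<^sub>M borel"
    by (intro borel_measurable_continuous_onI linear_continuous_on linear_linear) simp
  have fB [measurable]: "(\<lambda>x. f (B *v x)) \<in> borel_measurable lborel"
    by simp
  have fl [measurable]: "f \<in> borel_measurable lborel"
    by simp
  \<comment> \<open>The change of variables theorem speaks of vector-valued functions, so
    \<open>f\<close> is viewed as a map into \<open>real^1\<close>.\<close>
  define F :: "real^'m::_ \<Rightarrow> real^1" where "F x = vec (f x)" for x
  have lin: "linear ((*v) B)" and mat: "matrix ((*v) B) = B"
    by simp_all
  have "surj ((*v) B)"
    using B by (metis invertible_det_nz invertible_right_inverse matrix_right_invertible_surjective)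
  then have eq: "(\<lambda>x. \<bar>det B\<bar> * f (B *v x)) absolutely_integrable_on UNIV \<and>
        integral UNIV (\<lambda>x. \<bar>det B\<bar> * f (B *v x)) = b
    \<longleftrightarrow> f absolutely_integrable_on UNIV \<and> integral UNIV f = b" for b
    using has_absolute_integral_change_of_variables_linear [OF lin, where f = F and S = UNIV and b = "vec b"]
    by (simp add: F_def mat absolutely_integrable_on_1_iff integral_on_1_eq vec_eq_iff)
  \<comment> \<open>Absolute integrability refers to the completed measure; for Borel functions this
    makes no difference.\<close>
  have ai: "h absolutely_integrable_on UNIV \<longleftrightarrow> integrable lborel h"
    if "h \<in> borel_measurable lborel" for h :: "real^'m::_ \<Rightarrow> real"
    using integrable_completion [OF that] by (simp add: set_integrable_def)
  have eq': "integrable lborel (\<lambda>x. f (B *v x)) \<and>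
        integral UNIV (\<lambda>x. \<bar>det B\<bar> * f (B *v x)) = b
    \<longleftrightarrow> integrable lborel f \<and> integral UNIV f = b" for b
    using eq [of b] B by (simp add: ai)
  \<comment> \<open>Choosing \<open>b\<close> as the integral on either side reduces the equivalence
    to integrability alone.\<close>
  then show I: ?I by metis
  show ?E
  proof (cases "integrable lborel f")
    case True
    then have int: "integrable lborel (\<lambda>x. \<bar>det B\<bar> * f (B *v x))"
      using I by simp
    have "(LINT x|lborel. f x) = integral UNIV f"
      by (simp add: True integral_lborel)
    also have "\<dots> = integral UNIV (\<lambda>x. \<bar>det B\<bar> * f (B *v x))"
      using eq' [of "integral UNIV f"] True by simp
    also have "\<dots> = (LINT x|lborel. \<bar>det B\<bar> * f (B *v x))"
      by (rule integral_lborel [OF int])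
    finally show ?thesis by simp
  next
    case False
    then show ?thesis
      using I by (simp add: not_integrable_integral_eq)
  qed
qed

text \<open>Substitute \<open>x = B y\<close> with \<open>transpose B ** P ** B = mat 1\<close>: the
  form becomes \<open>y . y\<close>, and determinants give
  \<open>\<bar>det B\<bar> = 1 / sqrt (det P)\<close>.\<close>

lemma quadratic_form_substitution_wellorder:
  fixes P :: "real^'m::{finite,wellorder}^'m::{finite,wellorder}" and g :: "real \<Rightarrow> real"
  assumes P: "sym_pos_def P" and g: "g \<in> borel_measurable borel"
  shows "integrable lborel (\<lambda>x::real^'m::{finite,wellorder}. g (x \<bullet> x)) \<Longrightarrow>
           integrable lborel (\<lambda>x. g (x \<bullet> (P *v x)))"
    and "(LINT x|lborel. g (x \<bullet> (P *v x))) = (LINT x|lborel. g ((x::real^'m::{finite,wellorder}) \<bullet> x)) / sqrt (det P)"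
proof -
  obtain B :: "real^'m::_^'m::_" where B: "transpose B ** P ** B = mat 1"
    using sym_pos_def_congruent_mat_1 [OF P] .
  have "det (transpose B ** P ** B) = 1"
    by (simp add: B)
  then have det: "(det B)\<^sup>2 * det P = 1"
    by (simp add: det_mul power2_eq_square mult_ac)
  then have dB: "det B \<noteq> 0" by auto
  have dP: "0 < det P"
    by (rule sym_pos_def_det_pos [OF P])
  have "\<bar>det B\<bar> * sqrt (det P) = 1"
    by (rule power2_eq_imp_eq) (use det dP in \<open>auto simp: power_mult_distrib\<close>)
  then have sqrt: "\<bar>det B\<bar> = 1 / sqrt (det P)"
    using dP by (simp add: field_simps)
  have subst: "(B *v x) \<bullet> (P *v (B *v x)) = x \<bullet> x" for x
  proof -
    have "(B *v x) \<bullet> (P *v (B *v x)) = x \<bullet> (transpose B *v (P *v (B *v x)))"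
      by (metis dot_lmul_matrix inner_commute transpose_matrix_vector)
    then show ?thesis
      by (simp add: matrix_vector_mul_assoc B matrix_mul_assoc del: transpose_matrix_vector)
  qed
  have m: "(\<lambda>x. g (x \<bullet> (P *v x))) \<in> borel_measurable borel"
    by (intro measurable_compose [OF _ g] borel_measurable_continuous_onI continuous_intros
        linear_continuous_on linear_linear) simp
  show "integrable lborel (\<lambda>x::real^'m::_. g (x \<bullet> x)) \<Longrightarrow> integrable lborel (\<lambda>x. g (x \<bullet> (P *v x)))"
    using integrable_linear_substitution [OF m dB] by (simp add: subst)
  show "(LINT x|lborel. g (x \<bullet> (P *v x))) = (LINT x|lborel. g ((x::real^'m::_) \<bullet> x)) / sqrt (det P)"
    using integral_linear_substitution [OF m dB] by (simp add: subst sqrt)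
qed

text \<open>
  The determinant is that of \<open>P\<close> with its coordinates renamed along a bijection \<open>e\<close>. Its positivity
  and differentiability in \<open>P\<close> are all that is needed, so it is not identified with \<open>det P\<close>.
\<close>

lemma quadratic_form_substitution:
  obtains e :: "'n::finite idx \<Rightarrow> 'n" where
    "\<And>P::real^'n^'n. sym_pos_def P \<Longrightarrow> 0 < det (\<chi> a b. P $ e a $ e b)"
    "\<And>(P::real^'n^'n) g. sym_pos_def P \<Longrightarrow> g \<in> borel_measurable borel \<Longrightarrow>
       integrable lborel (\<lambda>x::real^'n. g (x \<bullet> x)) \<Longrightarrow>
       integrable lborel (\<lambda>x. g (x \<bullet> (P *v x)) :: real)"
    "\<And>(P::real^'n^'n) g. sym_pos_def P \<Longrightarrow> g \<in> borel_measurable borel \<Longrightarrow>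
       (LINT x|lborel. g (x \<bullet> (P *v x)) :: real)
         = (LINT x|lborel. g ((x::real^'n) \<bullet> x)) / sqrt (det (\<chi> a b. P $ e a $ e b))"
proof -
  obtain e :: "'n idx \<Rightarrow> 'n" where e: "bij e"
    using finite_same_card_bij [of "UNIV :: 'n idx set" "UNIV :: 'n set"] card_idx by auto
  let ?T = "\<lambda>y::real^'n idx. (\<chi> i. y $ inv e i) :: real^'n"
  let ?R = "\<lambda>P::real^'n^'n. (\<chi> a b. P $ e a $ e b) :: real^'n idx^'n idx"
  have inv: "inv e (e a) = a" "e (inv e i) = i" for a i
    using e by (simp_all add: bij_is_inj bij_is_surj surj_f_inv_f)
  have T [measurable]: "?T \<in> borel \<rightarrow>\<^sub>M borel"
    by (intro borel_measurable_continuous_onI continuous_intros)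
  \<comment> \<open>\<open>?T\<close> preserves inner products and Lebesgue measure and turns
    \<open>P\<close> into \<open>?R P\<close>, so the well-ordered case carries over.\<close>
  have form: "?T y \<bullet> (P *v ?T z) = y \<bullet> (?R P *v z)" for P y z
    unfolding inner_matrix_vector_sum
    by (simp add: sum.reindex_bij_betw [OF e, symmetric] inv)
  have norm: "?T y \<bullet> ?T z = y \<bullet> z" for y z
    by (simp add: inner_vec_def sum.reindex_bij_betw [OF e, symmetric] inv)
  have int_T: "integrable lborel f \<longleftrightarrow> integrable lborel (\<lambda>y. f (?T y))"
    and LINT_T: "(LINT x|lborel. f x) = (LINT y|lborel. f (?T y))"
    if f: "f \<in> borel_measurable borel" for f :: "real^'n \<Rightarrow> real"
    using integrable_distr_eq [of ?T lborel borel f] integral_distr [of ?T lborel borel f] f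
    by (simp_all add: lborel_distr_reindex [OF e])
  have spd: "sym_pos_def (?R P)" if P: "sym_pos_def P" for P
  proof -
    have "?R P $ a $ b = ?R P $ b $ a" for a b
      using P by (simp add: sym_pos_def_def transpose_def vec_eq_iff)
    moreover have "0 < y \<bullet> (?R P *v y)" if "y \<noteq> 0" for y
    proof -
      have "?T y \<noteq> 0"
        using that norm [of y y] by (metis inner_eq_zero_iff)
      then show ?thesis
        using P by (simp add: form [symmetric] sym_pos_def_def)
    qed
    ultimately show ?thesis
      by (simp add: sym_pos_def_def transpose_def vec_eq_iff)
  qed
  have meas: "(\<lambda>x. g (x \<bullet> (P *v x))) \<in> borel_measurable borel"
    if "g \<in> borel_measurable borel" for P :: "real^'n^'n" and g :: "real \<Rightarrow> real"
    by (intro measurable_compose [OF _ that] borel_measurable_continuous_onI continuous_intros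
        linear_continuous_on linear_linear) simp
  have meas': "(\<lambda>x::real^'n. g (x \<bullet> x)) \<in> borel_measurable borel"
    if "g \<in> borel_measurable borel" for g :: "real \<Rightarrow> real"
    by (intro measurable_compose [OF _ that] borel_measurable_continuous_onI continuous_intros)
  show thesis
  proof (rule that)
    fix P :: "real^'n^'n" and g :: "real \<Rightarrow> real"
    assume P: "sym_pos_def P"
    note quad = quadratic_form_substitution_wellorder [OF spd [OF P]]
    show "0 < det (?R P)"
      by (rule sym_pos_def_det_pos [OF spd [OF P]])
    assume g: "g \<in> borel_measurable borel"
    show "(LINT x|lborel. g (x \<bullet> (P *v x))) = (LINT x|lborel. g ((x::real^'n) \<bullet> x)) / sqrt (det (?R P))"
      using quad(2) [OF g] by (simp add: LINT_T meas meas' g form norm)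
    assume "integrable lborel (\<lambda>x::real^'n. g (x \<bullet> x))"
    then show "integrable lborel (\<lambda>x. g (x \<bullet> (P *v x)))"
      using quad(1) [OF g] by (simp add: int_T meas meas' g form norm)
  qed
qed

text \<open>Domination by dyadic balls: where \<open>2 ^ (n - 1) <= norm x < 2 ^ n\<close> the
  function is at most a constant times \<open>4 powr (- r * n)\<close>, while the ball of radius
  \<open>2 ^ n\<close> has volume proportional to \<open>2 ^ (n * d)\<close>. The resulting
  geometric series has ratio \<open>2 powr (d - 2 * r) < 1\<close>.\<close>

lemma integrable_radial_powr:
  fixes c r :: real
  assumes c: "0 < c" and r: "real DIM('a::euclidean_space) < 2 * r"
  shows "integrable lborel (\<lambda>x::'a. (1 + c * (x \<bullet> x)) powr (- r))"
proof (rule integrableI_bounded)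
  let ?f = "\<lambda>x::'a. (1 + c * (x \<bullet> x)) powr (- r)"
  \<comment> \<open>The 1 covers \<open>n = 0\<close>; for \<open>n > 0\<close> the bound
    \<open>norm x >= 2 ^ (n - 1)\<close> gives \<open>c * (x . x) >= c / 4 * 4 ^ n\<close>.\<close>
  define K where "K = max 1 ((c / 4) powr (- r))"
  define q where "q = 2 ^ DIM('a) * 4 powr (- r)"
  let ?V = "unit_ball_vol (real DIM('a))"
  have r0: "0 < r" using r by (smt (verit) of_nat_0_le_iff)
  have pos: "0 < 1 + c * (x \<bullet> x)" for x :: 'a
    using c by (simp add: add_pos_nonneg)
  show "?f \<in> borel_measurable lborel"
    unfolding measurable_lborel2
    by (intro borel_measurable_continuous_onI continuous_intros) (metis pos less_irrefl)
  have q: "0 \<le> q" "q < 1"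
  proof -
    have "q = 2 powr (real DIM('a) - 2 * r)"
      using powr_powr [of 2 2 "- r"] by (simp add: q_def powr_diff powr_realpow powr_minus field_simps)
    also have "\<dots> < 1"
      using r by (simp add: powr_less_one)
    finally show "q < 1" .
  qed (simp add: q_def)
  define h :: "nat \<Rightarrow> 'a \<Rightarrow> ennreal"
    where "h n x = ennreal (K * 4 powr (- r * real n)) * indicator (ball 0 (2 ^ n)) x" for n x
  have [measurable]: "h n \<in> borel_measurable lborel" for n
    unfolding h_def [abs_def]
    by (intro borel_measurable_times_ennreal borel_measurable_const borel_measurable_indicator) simp
  \<comment> \<open>The term at the least \<open>n\<close> with \<open>norm x < 2 ^ n\<close> already dominates.\<close>
  have bound: "ennreal (norm (?f x)) \<le> (\<Sum>n. h n x)" for x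
  proof -
    obtain m where "norm x < 2 ^ m"
      using real_arch_pow [of 2 "norm x"] by auto
    define n where "n = (LEAST n. norm x < 2 ^ n)"
    have n: "norm x < 2 ^ n"
      unfolding n_def by (rule LeastI) fact
    have fK: "?f x \<le> K * 4 powr (- r * real n)"
    proof (cases n)
      case 0
      have "?f x \<le> 1"
        using r0 c by (simp add: powr_minus inverse_le_1_iff ge_one_powr_ge_zero)
      then show ?thesis by (simp add: 0 K_def)
    next
      case (Suc k)
      have "\<not> norm x < 2 ^ k"
        unfolding n_def by (rule not_less_Least) (use Suc n_def in simp)
      then have "(2 ^ k)\<^sup>2 \<le> (norm x)\<^sup>2"
        by (intro power_mono) auto
      then have "4 ^ k \<le> x \<bullet> x"
        by (simp add: power2_norm_eq_inner power_mult [symmetric] mult.commute [of k] power_mult)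
      then have "c * 4 ^ k \<le> c * (x \<bullet> x)"
        using c by (intro mult_left_mono) auto
      then have "c / 4 * 4 ^ n \<le> 1 + c * (x \<bullet> x)"
        by (simp add: Suc)
      then have "?f x \<le> (c / 4 * 4 ^ n) powr (- r)"
        using r0 c by (intro powr_mono2') auto
      also have "\<dots> = (c / 4) powr (- r) * 4 powr (- r * real n)"
        using c by (subst powr_mult) (auto simp: powr_powr powr_realpow [symmetric] mult.commute)
      also have "\<dots> \<le> K * 4 powr (- r * real n)"
        by (intro mult_right_mono) (auto simp: K_def)
      finally show ?thesis .
    qed
    have "ennreal (norm (?f x)) \<le> h n x"
      using fK n by (simp add: ennreal_leI h_def)
    also have "\<dots> \<le> (\<Sum>n. h n x)"
      using sum_le_suminf [of "\<lambda>n. h n x" "{n}"] by simp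
    finally show ?thesis .
  qed
  have h_integral: "(\<integral>\<^sup>+ x. h n x \<partial>lborel) = ennreal (K * ?V * q ^ n)" for n
  proof -
    have "4 powr (- r * real n) = (4 powr (- r)) ^ n"
      by (simp only: powr_powr [symmetric] powr_realpow powr_gt_zero)
    then have eq: "K * 4 powr (- r * real n) * (?V * (2 ^ n) ^ DIM('a)) = K * ?V * q ^ n"
      by (simp add: q_def power_mult_distrib power_mult [symmetric] mult.commute [of n])
    have "(\<integral>\<^sup>+ x. h n x \<partial>lborel) = ennreal (K * 4 powr (- r * real n)) * ennreal (?V * (2 ^ n) ^ DIM('a))"
      by (simp add: h_def nn_integral_cmult_indicator emeasure_ball)
    also have "\<dots> = ennreal (K * ?V * q ^ n)"
      unfolding eq [symmetric] by (rule ennreal_mult' [symmetric]) (simp add: K_def)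
    finally show ?thesis .
  qed
  have "(\<integral>\<^sup>+ x. ennreal (norm (?f x)) \<partial>lborel)
      \<le> (\<integral>\<^sup>+ x. (\<Sum>n. h n x) \<partial>lborel)"
    by (intro nn_integral_mono bound)
  also have "\<dots> = (\<Sum>n. \<integral>\<^sup>+ x. h n x \<partial>lborel)"
    by (rule nn_integral_suminf) measurable
  also have "\<dots> = (\<Sum>n. ennreal (K * ?V * q ^ n))"
    by (simp only: h_integral)
  also have "(\<Sum>n. ennreal (K * ?V * q ^ n)) = ennreal (\<Sum>n. K * ?V * q ^ n)"
    using q by (intro suminf_ennreal2 summable_mult summable_geometric) (auto simp: K_def unit_ball_vol_nonneg)
  also have "\<dots> < \<infinity>" by simp
  finally show "(\<integral>\<^sup>+ x. ennreal (norm (?f x)) \<partial>lborel) < \<infinity>" .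
qed

section \<open>Differentiability and the parameter domain\<close>

lemma differentiable_prod:
  fixes f :: "'i \<Rightarrow> 'a::real_normed_vector \<Rightarrow> 'b::real_normed_field"
  assumes "finite I" "\<And>i. i \<in> I \<Longrightarrow> f i differentiable (at x within S)"
  shows "(\<lambda>x. \<Prod>i\<in>I. f i x) differentiable (at x within S)"
  using assms by (induction I rule: finite_induct) (auto intro: differentiable_mult)

lemma differentiable_det:
  fixes A :: "'a::real_normed_vector \<Rightarrow> 'b::real_normed_field^'n^'n"
  assumes "\<And>i j. (\<lambda>x. A x $ i $ j) differentiable (at x within S)"
  shows "(\<lambda>x. det (A x)) differentiable (at x within S)"
  unfolding det_def
  by (intro differentiable_sum differentiable_mult differentiable_const differentiable_prod assms
      finite_permutations finite ballI)

text \<open>Cramer's rule for column \<open>j\<close> of the inverse; as a quotient of determinants,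
  the entry is visibly differentiable.\<close>

lemma matrix_inv_nth:
  fixes A :: "'a::field^'n^'n"
  assumes "invertible A"
  shows "matrix_inv A $ i $ j = det (\<chi> r s. if s = i then axis j 1 $ r else A $ r $ s) / det A"
proof -
  have "A *v (matrix_inv A *v axis j 1) = axis j 1"
    by (simp add: matrix_vector_mul_assoc assms matrix_inv_mult)
  then have "matrix_inv A *v axis j 1 = (\<chi> k. det (\<chi> r s. if s = k then axis j 1 $ r else A $ r $ s) / det A)"
    using assms by (simp add: cramer invertible_det_nz)
  moreover have "(matrix_inv A *v axis j 1) $ i = matrix_inv A $ i $ j"
    by (simp add: matrix_vector_mult_def axis_def if_distrib [where f="(*) _"] cong: if_cong)
  ultimately show ?thesis by simp
qed

section \<open>The parameter domain and the inverse scale matrix\<close>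

lemma Upair_commute: "Upair i j = Upair j i"
  by simp

lemma transpose_scale_mat: "transpose (scale_mat \<eta>) = scale_mat \<eta>"
  by (simp add: transpose_def scale_mat_def vec_eq_iff Upair_commute)

text \<open>The complement \<open>C\<close> is the projection, along the compact unit sphere, of a
  closed set of pairs \<open>(x, \<eta>)\<close>, hence closed. Symmetry of the scale matrix is
  automatic.\<close>

lemma open_cauchy_params: "open (cauchy_params :: 'n::finite cauchy_param set)"
proof -
  let ?Q = "\<lambda>(x::real^'n) \<eta>::'n cauchy_param. x \<bullet> (scale_mat \<eta> *v x)"
  define C where "C = {\<eta>. \<exists>x. x \<in> sphere 0 1 \<and> (x, \<eta>) \<in> {p. ?Q (fst p) (snd p) \<le> 0}}"
  have "continuous_on UNIV (\<lambda>p. ?Q (fst p) (snd p))"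
    unfolding inner_matrix_vector_sum by (simp add: scale_mat_def) (intro continuous_intros)
  then have closed: "closed C"
    unfolding C_def
    by (intro closed_compact_projection closed_Collect_le continuous_on_const) auto
  have "\<eta> \<in> cauchy_params \<longleftrightarrow> \<eta> \<notin> C" for \<eta>
  proof
    assume "\<eta> \<in> cauchy_params"
    then show "\<eta> \<notin> C"
      by (auto simp: C_def cauchy_params_def sym_pos_def_def) (metis norm_zero not_le zero_neq_one)
  next
    assume C: "\<eta> \<notin> C"
    \<comment> \<open>The form is homogeneous of degree 2, so positivity on the unit sphere
      suffices.\<close>
    have "0 < ?Q x \<eta>" if "x \<noteq> 0" for x
    proof -
      have "norm (x /\<^sub>R norm x) = 1"
        using that by simp
      then have "0 < ?Q (x /\<^sub>R norm x) \<eta>"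
        using C unfolding C_def by (force simp del: norm_scaleR)
      then have "0 < inverse (norm x) * (inverse (norm x) * ?Q x \<eta>)"
        by (simp add: matrix_vector_mult_scaleR)
      then show ?thesis
        using that by (simp add: zero_less_mult_iff)
    qed
    then show "\<eta> \<in> cauchy_params"
      by (simp add: cauchy_params_def sym_pos_def_def transpose_scale_mat)
  qed
  then have "cauchy_params = - C"
    by blast
  with open_Compl [OF closed] show ?thesis
    by (rule back_subst [OF _ sym])
qed

lemma differentiable_vec_nth: "(\<lambda>\<eta>::real^'k. \<eta> $ i) differentiable F"
  using bounded_linear_vec_nth bounded_linear_imp_differentiable by blast

lemma differentiable_matrix_inv_scale_mat:
  fixes \<eta> :: "'n::finite cauchy_param"
  assumes "\<eta> \<in> cauchy_params"
  shows "(\<lambda>\<eta>. matrix_inv (scale_mat \<eta>) $ i $ j) differentiable (at \<eta>)"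
proof -
  let ?f = "\<lambda>\<eta>. det (\<chi> r s. if s = i then axis j 1 $ r else scale_mat \<eta> $ r $ s) / det (scale_mat \<eta>)"
  have "(\<lambda>\<eta>::'n cauchy_param. if s = i then axis j 1 $ r else scale_mat \<eta> $ r $ s) differentiable (at \<eta>)" for r s
    by (cases "s = i") (simp_all add: scale_mat_def differentiable_vec_nth)
  then have "?f differentiable (at \<eta>)"
    using assms sym_pos_def_det_pos [of "scale_mat \<eta>"]
    by (intro differentiable_divide differentiable_det)
       (auto simp: scale_mat_def differentiable_vec_nth cauchy_params_def)
  \<comment> \<open>Cramer's quotient is known to be the inverse only for invertible matrices;
    openness of the domain supplies a neighbourhood of them.\<close>
  moreover have "\<forall>\<^sub>F \<eta>' in at \<eta>. ?f \<eta>' = matrix_inv (scale_mat \<eta>') $ i $ j"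
    using eventually_at_topological [of "\<lambda>\<eta>'. \<eta>' \<in> cauchy_params" \<eta> UNIV] open_cauchy_params assms
    by (auto elim!: eventually_mono simp: cauchy_params_def matrix_inv_nth sym_pos_def_invertible)
  moreover have "?f \<eta> = matrix_inv (scale_mat \<eta>) $ i $ j"
    using assms by (simp add: cauchy_params_def matrix_inv_nth sym_pos_def_invertible)
  ultimately show ?thesis
    unfolding differentiable_def by (blast intro: has_derivative_transform_eventually)
qed

section \<open>Linear independence\<close>

text \<open>\<open>set_uprod (Upair i i)\<close> has one element, so the product has a single factor
  there and the exponent 2 makes it a square.\<close>

definition upair_monom :: "'n uprod \<Rightarrow> real^'n \<Rightarrow> real" where
  "upair_monom u x = (\<Prod>i\<in>set_uprod u. x $ i) ^ (if proper_uprod u then 1 else 2)"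

lemma upair_monom_Upair [simp]: "upair_monom (Upair i j) x = x $ i * x $ j"
  by (auto simp: upair_monom_def power2_eq_square)

text \<open>Ordered pairs are grouped by unordered pair. A fibre has one element on the diagonal and
  two off it, whence the factor \<open>2 - \<delta>\<^sub>i\<^sub>j\<close> in the weights.\<close>

lemma sum_uprod:
  fixes F :: "'n::finite \<Rightarrow> 'n \<Rightarrow> 'a::comm_semiring_0"
  shows "(\<Sum>i\<in>UNIV. \<Sum>j\<in>UNIV. F i j * G (Upair i j))
    = (\<Sum>u\<in>UNIV. (\<Sum>(i, j) | Upair i j = u. F i j) * G u)"
proof -
  have "(\<Sum>i\<in>UNIV. \<Sum>j\<in>UNIV. F i j * G (Upair i j)) = (\<Sum>p\<in>UNIV. case p of (i, j) \<Rightarrow> F i j * G (Upair i j))"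
    by (simp add: sum.cartesian_product)
  also have "\<dots> = (\<Sum>u\<in>UNIV. \<Sum>p\<in>{p\<in>UNIV. (case p of (i, j) \<Rightarrow> Upair i j) = u}. case p of (i, j) \<Rightarrow> F i j * G (Upair i j))"
    by (rule sum.group [symmetric]) auto
  also have "\<dots> = (\<Sum>u\<in>UNIV. (\<Sum>(i, j) | Upair i j = u. F i j) * G u)"
    by (intro sum.cong refl) (auto simp: sum_distrib_right case_prod_beta intro!: sum.cong)
  finally show ?thesis .
qed

text \<open>Polarization: by symmetry, expanding the form at \<open>u + v\<close> leaves
  \<open>2 * (u . A v) = 0\<close>.\<close>

lemma quadratic_form_zero_imp_zero:
  fixes A :: "real^'n^'n"
  assumes "transpose A = A" and "\<And>v. v \<bullet> (A *v v) = 0"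
  shows "A = 0"
proof -
  have "u \<bullet> (A *v v) = 0" for u v
    using assms(2) [of "u + v"] inner_symmetric_matrix [OF assms(1), of u v]
    by (simp add: assms(2) algebra_simps inner_add_left inner_add_right matrix_vector_right_distrib)
  then have "A *v v = 0 *v v" for v
    by (metis inner_eq_zero_iff matrix_vector_mult_0)
  then show ?thesis
    using matrix_eq by blast
qed

text \<open>Spreading each coefficient evenly over its ordered pairs gives a symmetric matrix
  \<open>A\<close> whose quadratic form is the given combination.\<close>

lemma lin_indep_upair_monom:
  fixes a :: "'n::finite uprod \<Rightarrow> real"
  assumes "\<And>x. (\<Sum>u\<in>UNIV. a u * upair_monom u x) = 0"
  shows "a u = 0"
proof -
  define m :: "'n uprod \<Rightarrow> real" where "m u = real (card {(i, j). Upair i j = u})" for u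
  define A :: "real^'n^'n" where "A = (\<chi> i j. a (Upair i j) / m (Upair i j))"
  have m: "m (Upair i j) \<noteq> 0" for i j
    by (auto simp: m_def card_eq_0_iff)
  have "(\<Sum>(i, j) | Upair i j = u. A $ i $ j) = a u" for u
  proof -
    have "(\<Sum>(i, j) | Upair i j = u. A $ i $ j) = (\<Sum>p\<in>{(i, j). Upair i j = u}. a u / m u)"
      by (intro sum.cong) (auto simp: A_def)
    also have "\<dots> = m u * (a u / m u)"
      by (simp add: m_def)
    also have "\<dots> = a u"
      using m by (cases u) simp
    finally show ?thesis .
  qed
  then have "x \<bullet> (A *v x) = 0" for x
    using sum_uprod [of "\<lambda>i j. A $ i $ j" "\<lambda>u. upair_monom u x"] assms
    by (simp add: inner_matrix_vector_sum)
  moreover have "transpose A = A"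
    by (simp add: transpose_def A_def vec_eq_iff Upair_commute)
  ultimately have "A = 0"
    by (intro quadratic_form_zero_imp_zero)
  then show ?thesis
    using m by (cases u) (simp add: A_def vec_eq_iff)
qed

lemma sum_UNIV_Plus:
  fixes F :: "'a::finite + 'b::finite \<Rightarrow> 'c::comm_monoid_add"
  shows "(\<Sum>k\<in>UNIV. F k) = (\<Sum>i\<in>UNIV. F (Inl i)) + (\<Sum>u\<in>UNIV. F (Inr u))"
  by (simp add: UNIV_Plus_UNIV [symmetric] sum.Plus del: UNIV_Plus_UNIV)

text \<open>Carries independence from a finite index type to the numbering by naturals that
  \<open>lin_indep_funs\<close> uses.\<close>

lemma lin_indep_funs_enumI:
  fixes F :: "'i::finite \<Rightarrow> 'a \<Rightarrow> real"
  assumes b: "bij_betw b {..<k} (UNIV :: 'i set)"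
    and F: "\<And>a. (\<And>x. x \<in> D \<Longrightarrow> (\<Sum>i\<in>UNIV. a i * F i x) = 0) \<Longrightarrow> (\<And>i. a i = 0)"
  shows "lin_indep_funs D k (\<lambda>m. F (b m))"
  unfolding lin_indep_funs_def
proof (intro allI impI)
  fix a m
  assume a: "\<forall>x\<in>D. (\<Sum>i<k. a i * F (b i) x) = 0" and m: "m < k"
  let ?a = "\<lambda>i. a (inv_into {..<k} b i)"
  have inv: "inv_into {..<k} b (b i) = i" if "i < k" for i
    using b that by (simp add: bij_betw_def inv_into_f_f)
  have "(\<Sum>i\<in>UNIV. ?a i * F i x) = (\<Sum>i<k. a i * F (b i) x)" for x
    by (subst sum.reindex_bij_betw [OF b, symmetric]) (simp add: inv)
  then have "?a (b m) = 0"
    using a by (intro F [of ?a]) simp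
  then show "a m = 0"
    by (simp add: inv m)
qed

lemma lin_indep_funs_case_nat_1_enumI:
  fixes F :: "'i::finite \<Rightarrow> 'a \<Rightarrow> real"
  assumes b: "bij_betw b {..<k} (UNIV :: 'i set)"
    and F: "\<And>a0 a. (\<And>x. x \<in> D \<Longrightarrow> a0 + (\<Sum>i\<in>UNIV. a i * F i x) = 0) \<Longrightarrow> a0 = 0 \<and> (\<forall>i. a i = 0)"
  shows "lin_indep_funs D (Suc k) (case_nat (\<lambda>_. 1) (\<lambda>m. F (b m)))"
  unfolding lin_indep_funs_def
proof (intro allI impI)
  fix a m
  assume a: "\<forall>x\<in>D. (\<Sum>i<Suc k. a i * (case i of 0 \<Rightarrow> \<lambda>_. 1 | Suc m \<Rightarrow> F (b m)) x) = 0"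
    and m: "m < Suc k"
  let ?a = "\<lambda>i. a (Suc (inv_into {..<k} b i))"
  have inv: "inv_into {..<k} b (b i) = i" if "i < k" for i
    using b that by (simp add: bij_betw_def inv_into_f_f)
  have "(\<Sum>i\<in>UNIV. ?a i * F i x) = (\<Sum>i<k. a (Suc i) * F (b i) x)" for x
    by (subst sum.reindex_bij_betw [OF b, symmetric]) (simp add: inv)
  then have "a 0 = 0 \<and> (\<forall>i. ?a i = 0)"
    using a by (intro F) (simp add: sum.lessThan_Suc_shift del: sum.lessThan_Suc)
  \<comment> \<open>Position 0 belongs to the constant function, so position \<open>m > 0\<close>
    belongs to index \<open>b (m - 1)\<close>.\<close>
  then show "a m = 0"
    using m inv by (cases m) (auto dest: spec [of _ "b (m - 1)"])
qed

text \<open>An unordered pair can only be read as \<open>(a, b)\<close> or \<open>(b, a)\<close>, so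
  symmetry makes its coordinate well defined.\<close>

lemma obtain_cauchy_param:
  fixes S :: "real^'n^'n" and \<mu> :: "real^'n"
  assumes "transpose S = S"
  obtains \<eta> where "scale_mat \<eta> = S" "loc \<eta> = \<mu>"
proof -
  have "\<exists>t. \<forall>i j. u = Upair i j \<longrightarrow> t = S $ i $ j" for u
  proof (cases u)
    case (Upair a b)
    have "S $ a $ b = S $ b $ a"
      using assms by (metis transpose_def vec_lambda_beta)
    then show ?thesis
      by (intro exI [of _ "S $ a $ b"]) (auto simp: Upair)
  qed
  then obtain t where t: "\<And>u i j. u = Upair i j \<Longrightarrow> t u = S $ i $ j"
    by metis
  show thesis
    by (rule that [of "\<chi> k. case k of Inl i \<Rightarrow> \<mu> $ i | Inr u \<Rightarrow> t u"])
      (simp_all add: scale_mat_def loc_def vec_eq_iff t)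
qed

section \<open>The Cauchy family\<close>

definition precision :: "'n::finite cauchy_param \<Rightarrow> real^'n^'n" where
  "precision \<eta> = matrix_inv (scale_mat \<eta>)"

text \<open>The value of the bracket in the kernel at \<open>x = 0\<close>. Dividing by it makes the
  constant term 1, as \<open>h\<close> may not depend on the parameter.\<close>

definition cauchy_base :: "real \<Rightarrow> 'n::finite cauchy_param \<Rightarrow> real" where
  "cauchy_base c \<eta> = 1 + c * (loc \<eta> \<bullet> (precision \<eta> *v loc \<eta>))"

definition cauchy_weight :: "real \<Rightarrow> 'n::finite + 'n uprod \<Rightarrow> 'n cauchy_param \<Rightarrow> real" where
  "cauchy_weight c k \<eta> = (case k of
      Inl i \<Rightarrow> - 2 * c * (precision \<eta> *v loc \<eta>) $ i
    | Inr u \<Rightarrow> c * (\<Sum>(i, j) | Upair i j = u. precision \<eta> $ i $ j)) / cauchy_base c \<eta>"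

definition cauchy_monom :: "'n::finite + 'n uprod \<Rightarrow> real^'n \<Rightarrow> real" where
  "cauchy_monom k x = (case k of Inl i \<Rightarrow> x $ i | Inr u \<Rightarrow> upair_monom u x)"

lemma sym_pos_def_precision: "\<eta> \<in> cauchy_params \<Longrightarrow> sym_pos_def (precision \<eta>)"
  by (simp add: precision_def cauchy_params_def sym_pos_def_matrix_inv)

lemma cauchy_base_pos:
  assumes "0 < c" "\<eta> \<in> cauchy_params"
  shows "0 < cauchy_base c \<eta>"
  using sym_pos_def_nonneg [OF sym_pos_def_precision [OF assms(2)]] assms(1)
  by (simp add: cauchy_base_def add_pos_nonneg)

text \<open>The numbers \<open>t k\<close> stay free for two uses: monomials at a point give the
  expansion of the kernel, coefficients of a linear relation give independence of the
  weights.\<close>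

lemma cauchy_base_mult_sum_weight:
  assumes c: "0 < c" and \<eta>: "\<eta> \<in> cauchy_params"
  shows "cauchy_base c \<eta> * (\<Sum>k\<in>UNIV. cauchy_weight c k \<eta> * t k)
    = c * (\<Sum>i\<in>UNIV. \<Sum>j\<in>UNIV. precision \<eta> $ i $ j * t (Inr (Upair i j)))
      - 2 * c * (\<Sum>i\<in>UNIV. (precision \<eta> *v loc \<eta>) $ i * t (Inl i))"
proof -
  let ?N = "cauchy_base c \<eta>"
  have N: "?N \<noteq> 0"
    using cauchy_base_pos [OF c \<eta>] by simp
  have "?N * (\<Sum>k\<in>UNIV. cauchy_weight c k \<eta> * t k) = (\<Sum>k\<in>UNIV. (?N * cauchy_weight c k \<eta>) * t k)"
    by (simp only: sum_distrib_left mult.assoc)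
  also have "\<dots> = (\<Sum>i\<in>UNIV. - 2 * c * (precision \<eta> *v loc \<eta>) $ i * t (Inl i))
      + (\<Sum>u\<in>UNIV. c * (\<Sum>(i, j) | Upair i j = u. precision \<eta> $ i $ j) * t (Inr u))"
    using N by (simp add: sum_UNIV_Plus cauchy_weight_def)
  also have "(\<Sum>i\<in>UNIV. - 2 * c * (precision \<eta> *v loc \<eta>) $ i * t (Inl i))
      = - 2 * c * (\<Sum>i\<in>UNIV. (precision \<eta> *v loc \<eta>) $ i * t (Inl i))"
    by (simp only: sum_distrib_left mult.assoc)
  also have "(\<Sum>u\<in>UNIV. c * (\<Sum>(i, j) | Upair i j = u. precision \<eta> $ i $ j) * t (Inr u))
      = c * (\<Sum>i\<in>UNIV. \<Sum>j\<in>UNIV. precision \<eta> $ i $ j * t (Inr (Upair i j)))"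
    by (simp only: sum_uprod [of _ "\<lambda>u. t (Inr u)"] sum_distrib_left [symmetric] mult.assoc)
  finally show ?thesis by simp
qed

lemma cauchy_quadratic_expansion:
  assumes c: "0 < c" and \<eta>: "\<eta> \<in> cauchy_params"
  shows "1 + c * ((x - loc \<eta>) \<bullet> (precision \<eta> *v (x - loc \<eta>)))
    = cauchy_base c \<eta> * (1 + (\<Sum>k\<in>UNIV. cauchy_weight c k \<eta> * cauchy_monom k x))"
proof -
  let ?P = "precision \<eta>" and ?\<mu> = "loc \<eta>"
  have "x \<bullet> (?P *v ?\<mu>) = (\<Sum>i\<in>UNIV. (?P *v ?\<mu>) $ i * x $ i)"
    by (simp add: inner_vec_def mult.commute)
  then have "cauchy_base c \<eta> * (\<Sum>k\<in>UNIV. cauchy_weight c k \<eta> * cauchy_monom k x)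
      = c * (x \<bullet> (?P *v x)) - 2 * c * (x \<bullet> (?P *v ?\<mu>))"
    unfolding cauchy_base_mult_sum_weight [OF c \<eta>]
    by (simp add: cauchy_monom_def inner_matrix_vector_sum)
  moreover have "?\<mu> \<bullet> (?P *v x) = x \<bullet> (?P *v ?\<mu>)"
    using sym_pos_def_precision [OF \<eta>] by (simp add: inner_symmetric_matrix sym_pos_def_def)
  ultimately show ?thesis
    by (simp add: distrib_left cauchy_base_def matrix_vector_mult_diff_distrib inner_diff_left
        inner_diff_right algebra_simps)
qed

section \<open>Independence of the monomials and of the weights\<close>

lemma lin_indep_cauchy_monom:
  fixes a :: "'n::finite + 'n uprod \<Rightarrow> real"
  assumes "\<And>x. (\<Sum>k\<in>UNIV. a k * cauchy_monom k x) = 0"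
  shows "a k = 0"
proof -
  let ?L = "\<lambda>x. \<Sum>i\<in>UNIV. a (Inl i) * x $ i" and ?Q = "\<lambda>x. \<Sum>u\<in>UNIV. a (Inr u) * upair_monom u x"
  have "?L x + ?Q x = 0" for x
    using assms [of x] by (simp add: sum_UNIV_Plus cauchy_monom_def)
  \<comment> \<open>The linear part is odd and the quadratic part even, so each vanishes
    separately.\<close>
  moreover have "?L (- x) = - ?L x" "?Q (- x) = ?Q x" for x
  proof -
    have "upair_monom u (- x) = upair_monom u x" for u
      by (cases u) simp
    then show "?L (- x) = - ?L x" "?Q (- x) = ?Q x"
      by (simp_all add: sum_negf)
  qed
  ultimately have LQ: "?L x + ?Q x = 0" "?Q x - ?L x = 0" for x
    by (metis, metis uminus_add_conv_diff)
  have L: "?L x = 0" for x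
    using LQ [of x] by linarith
  have Q: "?Q x = 0" for x
    using LQ [of x] by linarith
  show ?thesis
  proof (cases k)
    case (Inl i)
    then show ?thesis
      using L [of "axis i 1"] by (simp add: axis_def if_distrib [where f="(*) _"] cong: if_cong)
  next
    case (Inr u)
    then show ?thesis
      using lin_indep_upair_monom [OF Q] by simp
  qed
qed

lemma lin_indep_cauchy_weight:
  fixes a :: "'n::finite + 'n uprod \<Rightarrow> real"
  assumes c: "0 < c"
    and eq: "\<And>\<eta>. \<eta> \<in> cauchy_params \<Longrightarrow> a0 + (\<Sum>k\<in>UNIV. cauchy_weight c k \<eta> * a k) = 0"
  shows "a0 = 0 \<and> (\<forall>k. a k = 0)"
proof -
  define A :: "real^'n^'n" where "A = (\<chi> i j. a (Inr (Upair i j)))"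
  define S where "S P = (\<Sum>i\<in>UNIV. \<Sum>j\<in>UNIV. P $ i $ j * A $ i $ j)" for P :: "real^'n^'n"
  \<comment> \<open>Every positive definite \<open>P\<close> is the precision matrix of a parameter
    with scale matrix \<open>matrix_inv P\<close> and any prescribed location, so \<open>P\<close>
    and \<open>\<mu>\<close> vary independently.\<close>
  have cleared: "a0 * (1 + c * (\<mu> \<bullet> (P *v \<mu>))) - 2 * c * (\<Sum>i\<in>UNIV. (P *v \<mu>) $ i * a (Inl i)) + c * S P = 0"
    if P: "sym_pos_def P" for P \<mu>
  proof -
    have "transpose (matrix_inv P) = matrix_inv P"
      using sym_pos_def_matrix_inv [OF P] by (simp add: sym_pos_def_def)
    then obtain \<eta> where \<eta>: "scale_mat \<eta> = matrix_inv P" "loc \<eta> = \<mu>"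
      using obtain_cauchy_param by blast
    have \<eta>_in: "\<eta> \<in> cauchy_params"
      by (simp add: cauchy_params_def \<eta> sym_pos_def_matrix_inv P)
    have prec: "precision \<eta> = P"
      by (simp add: precision_def \<eta> matrix_inv_matrix_inv sym_pos_def_invertible P)
    let ?N = "cauchy_base c \<eta>"
    have "?N * (a0 + (\<Sum>k\<in>UNIV. cauchy_weight c k \<eta> * a k)) = 0"
      using eq [OF \<eta>_in] by simp
    then have "a0 * ?N + ?N * (\<Sum>k\<in>UNIV. cauchy_weight c k \<eta> * a k) = 0"
      by (simp only: distrib_left mult.commute)
    then have "a0 * ?N - 2 * c * (\<Sum>i\<in>UNIV. (P *v \<mu>) $ i * a (Inl i)) + c * S P = 0"
      unfolding cauchy_base_mult_sum_weight [OF c \<eta>_in] by (simp add: prec \<eta> S_def A_def)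
    then show ?thesis
      by (simp add: cauchy_base_def prec \<eta>)
  qed
  have centred: "a0 + c * S P = 0" if "sym_pos_def P" for P
    using cleared [OF that, of 0] by simp
  \<comment> \<open>By homogeneity of \<open>S\<close>, both \<open>a0 + c * S (mat 1)\<close> and
    \<open>a0 + 2 * c * S (mat 1)\<close> vanish, which forces \<open>a0 = 0\<close>.\<close>
  have "S (2 *\<^sub>R mat 1) = 2 * S (mat 1)"
    by (simp add: S_def sum_distrib_left mult.assoc)
  then have a0: "a0 = 0"
    using centred [OF sym_pos_def_mat_1] centred [OF sym_pos_def_scaleR [OF sym_pos_def_mat_1, of 2]]
    by simp
  then have S: "S P = 0" if "sym_pos_def P" for P
    using centred [OF that] c by simp
  have lin: "(\<Sum>i\<in>UNIV. \<mu> $ i * a (Inl i)) = 0" for \<mu>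
    using cleared [OF sym_pos_def_mat_1, of \<mu>] c by (simp add: a0 S sym_pos_def_mat_1)
  have "a (Inl i) = 0" for i
    using lin [of "axis i 1"] by (simp add: axis_def if_distrib [where f="\<lambda>t. t * _"] cong: if_cong)
  moreover have "a (Inr u) = 0" for u
  proof -
    have "v \<bullet> (A *v v) = 0" for v
    proof -
      \<comment> \<open>\<open>S\<close> is additive and sends \<open>v v^T\<close> to
        \<open>v . A v\<close>.\<close>
      have "S (\<chi> i j. (if i = j then 1 else 0) + v $ i * v $ j) = S (mat 1) + v \<bullet> (A *v v)"
        by (simp add: S_def inner_matrix_vector_sum mat_def algebra_simps sum.distrib)
      then show ?thesis
        by (simp add: S sym_pos_def_mat_1 sym_pos_def_mat_1_plus_outer)
    qed
    moreover have "transpose A = A"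
      by (simp add: A_def transpose_def vec_eq_iff Upair_commute)
    ultimately have "A = 0"
      by (intro quadratic_form_zero_imp_zero)
    then show ?thesis
      by (cases u) (simp add: A_def vec_eq_iff)
  qed
  ultimately have "a k = 0" for k
    by (cases k) auto
  with a0 show ?thesis by blast
qed

section \<open>Differentiability of the weights and of their denominator\<close>

lemma differentiable_real_sqrt:
  assumes "f differentiable (at x)" "0 < f x"
  shows "(\<lambda>x. sqrt (f x)) differentiable (at x)"
proof -
  obtain f' where "(f has_derivative f') (at x)"
    using assms(1) by (auto simp: differentiable_def)
  from has_derivative_real_sqrt [OF assms(2) this] show ?thesis
    by (auto simp: differentiable_def)
qed

lemma differentiable_powr_const:
  fixes r :: real
  assumes "f differentiable (at x)" "0 < f x"
  shows "(\<lambda>x. f x powr r) differentiable (at x)"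
proof -
  obtain f' where "(f has_derivative f') (at x)"
    using assms(1) by (auto simp: differentiable_def)
  from has_derivative_powr [OF this has_derivative_const assms(2) UNIV_I] show ?thesis
    by (auto simp: differentiable_def)
qed

lemma differentiable_precision:
  assumes "\<eta> \<in> cauchy_params"
  shows "(\<lambda>\<eta>. precision \<eta> $ i $ j) differentiable (at \<eta>)"
  unfolding precision_def by (rule differentiable_matrix_inv_scale_mat [OF assms])

lemma differentiable_precision_loc:
  fixes \<eta> :: "'n::finite cauchy_param"
  assumes "\<eta> \<in> cauchy_params"
  shows "(\<lambda>\<eta>. (precision \<eta> *v loc \<eta>) $ i) differentiable (at \<eta>)"
  by (simp add: matrix_vector_mult_def loc_def differentiable_mult differentiable_precision
      differentiable_vec_nth assms)

lemma differentiable_cauchy_base: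
  fixes \<eta> :: "'n::finite cauchy_param"
  assumes "\<eta> \<in> cauchy_params"
  shows "cauchy_base c differentiable (at \<eta>)"
proof -
  have "(\<lambda>\<eta>::'n cauchy_param. loc \<eta> $ i) differentiable (at \<eta>)" for i
    by (simp add: loc_def differentiable_vec_nth)
  then have "(\<lambda>\<eta>. 1 + c * (\<Sum>i\<in>UNIV. loc \<eta> $ i * (precision \<eta> *v loc \<eta>) $ i)) differentiable (at \<eta>)"
    by (intro differentiable_add differentiable_mult differentiable_const differentiable_sum
        differentiable_precision_loc assms ballI finite)
  then show ?thesis
    by (simp add: cauchy_base_def [abs_def] inner_vec_def)
qed

lemma differentiable_cauchy_weight:
  assumes c: "0 < c" and \<eta>: "\<eta> \<in> cauchy_params"
  shows "cauchy_weight c k differentiable (at \<eta>)"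
proof -
  have "(\<lambda>\<eta>. case k of
      Inl i \<Rightarrow> - 2 * c * (precision \<eta> *v loc \<eta>) $ i
    | Inr u \<Rightarrow> c * (\<Sum>(i, j) | Upair i j = u. precision \<eta> $ i $ j)) differentiable (at \<eta>)"
    by (cases k) (simp_all add: differentiable_mult differentiable_precision differentiable_precision_loc
        \<eta> case_prod_beta)
  then show ?thesis
    unfolding cauchy_weight_def [abs_def]
    by (intro differentiable_divide differentiable_cauchy_base \<eta>)
      (use cauchy_base_pos [OF c \<eta>] in auto)
qed

section \<open>Positivity of the coefficient and the normalizing integral\<close>

lemma c_coeff_pos:
  assumes "1 < \<beta>" and "\<beta> < (real d + 2) / real d"
  shows "0 < c_coeff d \<beta>"
proof -
  \<comment> \<open>Division by zero yields 0, so \<open>d = 0\<close> would give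
    \<open>1 < \<beta> < 0\<close>.\<close>
  have "real d \<noteq> 0"
    using assms by (intro notI) simp
  then have "real d * (\<beta> - 1) < 2"
    using assms(2) by (simp add: field_simps)
  then have "real d * (1 - 1 / \<beta>) < 2"
    using assms(1) by (simp add: field_simps)
  then show ?thesis
    using assms(1) by (simp add: c_coeff_def b_coeff_def)
qed

text \<open>Translation centres the kernel and the linear substitution reduces it to the radial
  integral \<open>C\<close>. Since \<open>e\<close> and \<open>C\<close> do not depend on
  \<open>\<eta>\<close>, the formula can be differentiated in the parameter.\<close>

lemma integral_cauchy_kernel:
  fixes \<beta> :: real
  assumes \<beta>: "1 < \<beta>" "\<beta> < (real CARD('n::finite) + 2) / real CARD('n)"
  obtains e :: "'n::finite idx \<Rightarrow> 'n" and C where "0 < C"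
    "\<And>\<eta>. \<eta> \<in> cauchy_params \<Longrightarrow> 0 < det (\<chi> a b. precision \<eta> $ e a $ e b)"
    "\<And>\<eta>::'n cauchy_param. \<eta> \<in> cauchy_params \<Longrightarrow> integrable lborel (cauchy_kernel \<beta> \<eta>)"
    "\<And>\<eta>. \<eta> \<in> cauchy_params \<Longrightarrow>
       (LINT x|lborel. cauchy_kernel \<beta> \<eta> x) = C / sqrt (det (\<chi> a b. precision \<eta> $ e a $ e b))"
proof -
  let ?c = "c_coeff CARD('n) \<beta>"
  define g where "g t = (1 + ?c * t) powr (1 / (1 - \<beta>))" for t
  have c: "0 < ?c" by (rule c_coeff_pos [OF \<beta>])
  have g [measurable]: "g \<in> borel_measurable borel"
    unfolding g_def by measurable
  \<comment> \<open>The upper bound on \<open>\<beta>\<close>, rearranged, is exactly the condition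
    for radial convergence.\<close>
  have r: "real DIM(real^'n) < 2 * (1 / (\<beta> - 1))"
    using \<beta> by (simp add: field_simps)
  have "- (1 / (\<beta> - 1)) = 1 / (1 - \<beta>)"
    using \<beta> by (simp add: field_simps)
  then have int: "integrable lborel (\<lambda>x::real^'n. g (x \<bullet> x))"
    using integrable_radial_powr [OF c r] by (simp add: g_def)
  define C where "C = (LINT x|lborel. g ((x::real^'n) \<bullet> x))"
  have g_pos: "0 < g (x \<bullet> x)" for x :: "real^'n"
  proof -
    have "0 < 1 + ?c * (x \<bullet> x)"
      using c by (simp add: add_pos_nonneg)
    then show ?thesis by (simp add: g_def)
  qed
  \<comment> \<open>A nonnegative function with integral 0 vanishes almost everywhere, but
    \<open>g (x . x)\<close> is positive everywhere.\<close>
  have "C \<noteq> 0"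
  proof
    assume "C = 0"
    then have "AE x::real^'n in lborel. g (x \<bullet> x) = 0"
      using integral_nonneg_eq_0_iff_AE [OF int] g_pos by (simp add: C_def less_imp_le)
    then have "AE x::real^'n in lborel. False"
      using g_pos by (auto elim: AE_mp simp: less_le)
    then show False
      by (simp add: eventually_False ae_filter_eq_bot_iff)
  qed
  moreover have "0 \<le> C"
    unfolding C_def by (rule integral_nonneg_AE) (simp add: g_pos less_imp_le)
  ultimately have C: "0 < C" by simp
  obtain e :: "'n idx \<Rightarrow> 'n" where e:
    "\<And>P::real^'n^'n. sym_pos_def P \<Longrightarrow> 0 < det (\<chi> a b. P $ e a $ e b)"
    "\<And>(P::real^'n^'n) g. sym_pos_def P \<Longrightarrow> g \<in> borel_measurable borel \<Longrightarrow>
       integrable lborel (\<lambda>x::real^'n. g (x \<bullet> x)) \<Longrightarrow>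
       integrable lborel (\<lambda>x. g (x \<bullet> (P *v x)) :: real)"
    "\<And>(P::real^'n^'n) g. sym_pos_def P \<Longrightarrow> g \<in> borel_measurable borel \<Longrightarrow>
       (LINT x|lborel. g (x \<bullet> (P *v x)) :: real)
         = (LINT x|lborel. g ((x::real^'n) \<bullet> x)) / sqrt (det (\<chi> a b. P $ e a $ e b))"
    by (rule quadratic_form_substitution) (rule that)
  have shift: "integrable lborel (cauchy_kernel \<beta> \<eta>) \<longleftrightarrow> integrable lborel (\<lambda>x. g (x \<bullet> (precision \<eta> *v x)))"
      "(LINT x|lborel. cauchy_kernel \<beta> \<eta> x) = (LINT x|lborel. g (x \<bullet> (precision \<eta> *v x)))"
    for \<eta> :: "'n cauchy_param"
  proof -
    have eq: "cauchy_kernel \<beta> \<eta> = (\<lambda>x. g ((x - loc \<eta>) \<bullet> (precision \<eta> *v (x - loc \<eta>))))"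
      by (simp add: fun_eq_iff cauchy_kernel_def g_def precision_def)
    have "(\<lambda>x. g (x \<bullet> (precision \<eta> *v x))) \<in> borel_measurable borel"
      by (intro measurable_compose [OF _ g] borel_measurable_continuous_onI continuous_intros
          linear_continuous_on linear_linear) simp
    then have K: "cauchy_kernel \<beta> \<eta> \<in> borel_measurable borel"
      unfolding eq by (rule measurable_compose [rotated]) simp
    have T: "(+) (loc \<eta>) \<in> lborel \<rightarrow>\<^sub>M borel" by simp
    show "integrable lborel (cauchy_kernel \<beta> \<eta>) \<longleftrightarrow> integrable lborel (\<lambda>x. g (x \<bullet> (precision \<eta> *v x)))"
      using integrable_distr_eq [OF T K] by (simp add: lborel_distr_plus) (simp add: eq)
    show "(LINT x|lborel. cauchy_kernel \<beta> \<eta> x) = (LINT x|lborel. g (x \<bullet> (precision \<eta> *v x)))"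
      using integral_distr [OF T K] by (simp add: lborel_distr_plus) (simp add: eq)
  qed
  show thesis
  proof (rule that [OF C, of e])
    fix \<eta> :: "'n cauchy_param"
    assume "\<eta> \<in> cauchy_params"
    then have P: "sym_pos_def (precision \<eta>)"
      by (rule sym_pos_def_precision)
    show "0 < det (\<chi> a b. precision \<eta> $ e a $ e b)"
      by (rule e(1) [OF P])
    show "integrable lborel (cauchy_kernel \<beta> \<eta>)"
      using e(2) [OF P g int] by (simp add: shift)
    show "(LINT x|lborel. cauchy_kernel \<beta> \<eta> x) = C / sqrt (det (\<chi> a b. precision \<eta> $ e a $ e b))"
      using e(3) [OF P g] by (simp add: shift C_def)
  qed
qed

section \<open>Dimension count and assembly\<close>

lemma card_cauchy_index:
  "CARD('n::finite + 'n uprod) = CARD('n) * (CARD('n) + 3) div 2"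
proof -
  let ?n = "CARD('n)"
  \<comment> \<open>Halving the two summands counts the unordered pairs and the locations.\<close>
  have "?n * (?n + 3) = ?n * (?n + 1) + ?n * 2"
    by (simp add: algebra_simps)
  then show ?thesis
    by (simp add: card_UNIV_uprod)
qed

theorem mainTheorem3:
  fixes \<beta> :: real
  assumes "1 < \<beta>" and "\<beta> < (real CARD('n::finite) + 2) / real CARD('n)"
  shows "regular_E_family \<beta> (CARD('n) * (CARD('n) + 3) div 2)
           (cauchy_params :: 'n cauchy_param set)
           (cauchy_density \<beta> :: 'n cauchy_param \<Rightarrow> real^'n \<Rightarrow> real)"
proof -
  let ?c = "c_coeff CARD('n) \<beta>" and ?k = "CARD('n + 'n uprod)"
  have c: "0 < ?c" by (rule c_coeff_pos [OF assms])
  obtain e :: "'n idx \<Rightarrow> 'n" and C where C: "0 < C"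
    and det: "\<And>\<eta>. \<eta> \<in> cauchy_params \<Longrightarrow> 0 < det (\<chi> a b. precision \<eta> $ e a $ e b)"
    and int: "\<And>\<eta>::'n cauchy_param. \<eta> \<in> cauchy_params \<Longrightarrow> integrable lborel (cauchy_kernel \<beta> \<eta>)"
    and LINT: "\<And>\<eta>. \<eta> \<in> cauchy_params \<Longrightarrow>
       (LINT x|lborel. cauchy_kernel \<beta> \<eta> x) = C / sqrt (det (\<chi> a b. precision \<eta> $ e a $ e b))"
    by (rule integral_cauchy_kernel [OF assms]) (rule that)
  obtain b where b: "bij_betw b {..<?k} (UNIV :: ('n + 'n uprod) set)"
    using ex_bij_betw_nat_finite [OF finite [of "UNIV :: ('n + 'n uprod) set"]] by (auto simp: lessThan_atLeast0)
  let ?w = "\<lambda>m. cauchy_weight ?c (b m)" and ?f = "\<lambda>m. cauchy_monom (b m)"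
  \<comment> \<open>The first factor is the normalizing constant in its differentiable form; the
    second is the power of \<open>cauchy_base\<close> taken out of the bracket.\<close>
  define Z where "Z \<eta> = sqrt (det (\<chi> a b. precision \<eta> $ e a $ e b)) / C * cauchy_base ?c \<eta> powr (1 / (1 - \<beta>))"
    for \<eta> :: "'n cauchy_param"
  have const: "cauchy_const \<beta> \<eta> = sqrt (det (\<chi> a b. precision \<eta> $ e a $ e b)) / C"
    and const_pos: "0 < cauchy_const \<beta> \<eta>"
    if "\<eta> \<in> cauchy_params" for \<eta>
    using C det [OF that] by (simp_all add: cauchy_const_def LINT that)
  have kernel: "cauchy_kernel \<beta> \<eta> x = (cauchy_base ?c \<eta> * (1 + (\<Sum>m<?k. ?w m \<eta> * ?f m x))) powr (1 / (1 - \<beta>))"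
    and pos: "0 < 1 + (\<Sum>m<?k. ?w m \<eta> * ?f m x)" if \<eta>: "\<eta> \<in> cauchy_params" for \<eta> x
  proof -
    have eq: "1 + ?c * ((x - loc \<eta>) \<bullet> (precision \<eta> *v (x - loc \<eta>)))
      = cauchy_base ?c \<eta> * (1 + (\<Sum>m<?k. ?w m \<eta> * ?f m x))"
      unfolding cauchy_quadratic_expansion [OF c \<eta>] by (subst sum.reindex_bij_betw [OF b]) simp
    then show "cauchy_kernel \<beta> \<eta> x = (cauchy_base ?c \<eta> * (1 + (\<Sum>m<?k. ?w m \<eta> * ?f m x))) powr (1 / (1 - \<beta>))"
      by (simp add: cauchy_kernel_def precision_def)
    \<comment> \<open>The original bracket is positive and equals the new one times the positive
      \<open>cauchy_base\<close>.\<close>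
    have "0 < 1 + ?c * ((x - loc \<eta>) \<bullet> (precision \<eta> *v (x - loc \<eta>)))"
      using c sym_pos_def_nonneg [OF sym_pos_def_precision [OF \<eta>]] by (simp add: add_pos_nonneg)
    then show "0 < 1 + (\<Sum>m<?k. ?w m \<eta> * ?f m x)"
      unfolding eq using cauchy_base_pos [OF c \<eta>] by (simp add: zero_less_mult_iff)
  qed
  have density_pos: "0 < cauchy_density \<beta> \<eta> x" if "\<eta> \<in> cauchy_params" for \<eta> :: "'n cauchy_param" and x
    using const_pos [OF that] cauchy_base_pos [OF c that] pos [OF that, of x]
    by (simp add: cauchy_density_def kernel [OF that])
  have "prob_density (cauchy_density \<beta> \<eta>)" if \<eta>: "\<eta> \<in> cauchy_params" for \<eta> :: "'n cauchy_param"
    using density_pos [OF \<eta>, THEN less_imp_le] int [OF \<eta>] const_pos [OF \<eta>]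
    unfolding prob_density_def by (auto simp: cauchy_density_def [abs_def] cauchy_const_def)
  moreover have "support_on UNIV (cauchy_density \<beta> \<eta>) = UNIV" if "\<eta> \<in> cauchy_params" for \<eta> :: "'n cauchy_param"
    using density_pos [OF that] by (auto simp: support_on_def less_le)
  moreover have "?w m differentiable_on cauchy_params" for m
    by (auto simp: differentiable_on_def intro: differentiable_at_withinI differentiable_cauchy_weight [OF c])
  moreover have "Z differentiable_on cauchy_params"
  proof -
    have "Z differentiable (at \<eta>)" if \<eta>: "\<eta> \<in> cauchy_params" for \<eta> :: "'n cauchy_param"
    proof -
      have "(\<lambda>\<eta>. det (\<chi> a b. precision \<eta> $ e a $ e b)) differentiable (at \<eta>)"
        by (rule differentiable_det) (simp add: differentiable_precision [OF \<eta>])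
      then have "(\<lambda>\<eta>. sqrt (det (\<chi> a b. precision \<eta> $ e a $ e b))) differentiable (at \<eta>)"
        by (rule differentiable_real_sqrt) (rule det [OF \<eta>])
      moreover have "(\<lambda>\<eta>. cauchy_base ?c \<eta> powr (1 / (1 - \<beta>))) differentiable (at \<eta>)"
        by (intro differentiable_powr_const differentiable_cauchy_base \<eta> cauchy_base_pos c)
      ultimately show ?thesis
        unfolding Z_def [abs_def]
        by (intro differentiable_mult differentiable_divide differentiable_const) (use C in auto)
    qed
    then show ?thesis
      by (auto simp: differentiable_on_def intro: differentiable_at_withinI)
  qed
  \<comment> \<open>Both factors of the bracket are positive, so \<open>powr\<close> distributes
    over their product.\<close>
  moreover have "cauchy_density \<beta> \<eta> x = Z \<eta> * (1 + (\<Sum>m<?k. ?w m \<eta> * ?f m x)) powr (1 / (1 - \<beta>))"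
    if \<eta>: "\<eta> \<in> cauchy_params" for \<eta> :: "'n cauchy_param" and x
    using cauchy_base_pos [OF c \<eta>] pos [OF \<eta>, of x]
    by (simp add: cauchy_density_def kernel [OF \<eta>] Z_def const [OF \<eta>] powr_mult)
  ultimately have "E_family \<beta> ?k cauchy_params (\<lambda>_. UNIV) (cauchy_density \<beta>) ?k (\<lambda>_. 1) ?w ?f"
    unfolding E_family_def using assms(1) open_cauchy_params pos by fastforce
  moreover have "lin_indep_funs cauchy_params (Suc ?k) (case_nat (\<lambda>_. 1) ?w)"
    by (rule lin_indep_funs_case_nat_1_enumI [OF b])
      (rule lin_indep_cauchy_weight [OF c], simp add: mult.commute)
  moreover have "lin_indep_funs UNIV ?k ?f"
    by (rule lin_indep_funs_enumI [OF b]) (rule lin_indep_cauchy_monom, simp)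
  ultimately show ?thesis
    unfolding regular_E_family_def card_cauchy_index [symmetric] by blast
qed

end
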